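(* Let $s,k\ge 2$ be integers and let $\mathcal H$ be a graph with vertex set $\{1,\dots,k\}$. For each positive integer $n$, let $X^1,\dots,X^k$ be lattice points chosen independently and uniformly at random from $\{1,\dots,n\}^s$. Then $$\lim_{n\to\infty}\mathbb P\big((X^1,\dots,X^k)\text{ is }\mathcal H\text{-visible}\big)=\zeta_{\mathcal H}(s)^{-1},\qquad\text{where } \zeta_{\mathcal H}(s)=\prod_p\left(\frac{P_{\mathcal H}(p^s)}{p^{ks}}\right)^{-1},$$ the product running over all primes $p$, and $P_{\mathcal H}$ being the chromatic polynomial of $\mathcal H$.
   Context: Two distinct points $X,Y\in\mathbb Z^s$ are called mutually visible, written $X\diamond Y$, if the closed line segment joining them contains no lattice point of $\mathbb Z^s$ other than $X$ and $Y$ (so $X\diamond Y$ requires $X\ne Y$). Given a graph $\mathcal H$ on vertex set $\{1,\dots,k\}$, a sequence of lattice points $(X^1,\dots,X^k)$ is called $\mathcal H$-visible if $X^i\diamond X^j$ whenever $\{i,j\}$ is an edge of $\mathcal H$. The chromatic polynomial $P_{\mathcal H}(x)$ is the polynomial whose value at a positive integer $x$ is the number of proper colorings of the (labeled) vertices of $\mathcal H$ with $x$ colours, i.e. assignments of colours such that adjacent vertices receive different colours. The function $\zeta_{\mathcal H}$ is called the chromatic zeta function of $\mathcal H$. *)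

theory Defs
  imports
    "HOL-Probability.Probability"
    "HOL-Computational_Algebra.Polynomial"
    "HOL-Computational_Algebra.Primes"
    "Graph_Theory.Pair_Digraph"
begin

text \<open>Points of \<open>\<int>\<^sup>s\<close> have type \<open>int ^ 's\<close> with \<open>s = CARD('s)\<close>.\<close>

definition real_vec :: "int ^ 's \<Rightarrow> real ^ 's" where
  "real_vec X = (\<chi> i. real_of_int (X $ i))"

definition mutually_visible :: "int ^ 's \<Rightarrow> int ^ 's \<Rightarrow> bool" where
  "mutually_visible X Y \<longleftrightarrow>
     X \<noteq> Y \<and> (\<forall>Z. real_vec Z \<in> closed_segment (real_vec X) (real_vec Y) \<longrightarrow> Z = X \<or> Z = Y)"

text \<open>
  A graph is a symmetric loop-free \<open>pair_pre_digraph\<close> (locale \<open>pair_graph\<close>): the undirected edge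
  \<open>{u, v}\<close> is represented by the two pairs \<open>(u, v)\<close> and \<open>(v, u)\<close> in \<open>parcs\<close>.
\<close>

definition graph_visible :: "'a pair_pre_digraph \<Rightarrow> ('a \<Rightarrow> int ^ 's) \<Rightarrow> bool" where
  "graph_visible H X \<longleftrightarrow> (\<forall>(u, v) \<in> parcs H. mutually_visible (X u) (X v))"

definition proper_colorings :: "'a pair_pre_digraph \<Rightarrow> nat \<Rightarrow> ('a \<Rightarrow> nat) set" where
  "proper_colorings H x = {c \<in> pverts H \<rightarrow>\<^sub>E {1..x}. \<forall>(u, v) \<in> parcs H. c u \<noteq> c v}"

definition chromatic_poly :: "'a pair_pre_digraph \<Rightarrow> real poly" where
  "chromatic_poly H =
     (THE P. \<forall>x::nat. x > 0 \<longrightarrow> poly P (real x) = real (card (proper_colorings H x)))"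

text \<open>
  The Euler product is taken in \<^typ>\<open>ennreal\<close>, where all its factors are at least \<open>1\<close>, because a
  factor can be infinite: \<open>P\<^sub>H (p\<^sup>s) = 0\<close> if \<open>H\<close> has no proper coloring with \<open>p\<^sup>s\<close> colors. In that
  case the value is \<open>\<infinity>\<close> and its inverse is \<open>0\<close>.
\<close>

definition chromatic_zeta :: "'a pair_pre_digraph \<Rightarrow> nat \<Rightarrow> ennreal" where
  "chromatic_zeta H s =
     (\<Prod>p. if prime p
           then inverse (ennreal (poly (chromatic_poly H) (real (p ^ s)) /
                                  real (p ^ (card (pverts H) * s))))
           else 1)"

definition cube :: "nat \<Rightarrow> (int ^ 's) set" where
  "cube n = {X. \<forall>i. X $ i \<in> {1..int n}}"

definition random_points :: "nat \<Rightarrow> nat \<Rightarrow> (nat \<Rightarrow> int ^ 's) pmf" where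
  "random_points k n = Pi_pmf {1..k} undefined (\<lambda>_. pmf_of_set (cube n))"


text \<open>The chromatic polynomial is well defined, and so is the uniform distribution on the cube.\<close>

lemma card_onto_colorings:
  fixes H :: "'a pair_pre_digraph"
  assumes "pair_wf_digraph H" "S \<subseteq> {1..x}"
  shows "card {c \<in> proper_colorings H x. c ` pverts H = S} =
         card {c \<in> proper_colorings H (card S). c ` pverts H = {1..card S}}"
proof -
  define V where "V = pverts H"
  have wf: "u \<in> V" "v \<in> V" if "(u, v) \<in> parcs H" for u v
    using pair_wf_digraph.in_arcsD1[OF assms(1) that] pair_wf_digraph.in_arcsD2[OF assms(1) that]
    by (auto simp: V_def)
  have "finite S" using assms(2) finite_subset by blast
  then obtain h where h: "bij_betw h S {1..card S}"
    using finite_same_card_bij[of S "{1..card S}"] by auto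
  let ?A = "{c \<in> proper_colorings H x. c ` V = S}"
  let ?B = "{c \<in> proper_colorings H (card S). c ` V = {1..card S}}"
  let ?g = "inv_into S h"
  have g: "bij_betw ?g {1..card S} S" using h by (rule bij_betw_inv_into)
  have hg: "h (?g i) = i" if "i \<in> {1..card S}" for i
    using h that by (simp add: bij_betw_inv_into_right)
  have gh: "?g (h i) = i" if "i \<in> S" for i
    using h that by (simp add: bij_betw_inv_into_left)
  have hS: "h ` S = {1..card S}" and gS: "?g ` {1..card S} = S"
    using h g by (auto simp: bij_betw_def)
  have "bij_betw (\<lambda>c. restrict (h \<circ> c) V) ?A ?B"
  proof (rule bij_betwI[where g = "\<lambda>c. restrict (?g \<circ> c) V"])
    show "(\<lambda>c. restrict (h \<circ> c) V) \<in> ?A \<rightarrow> ?B"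
    proof
      fix c assume c: "c \<in> ?A"
      have im: "restrict (h \<circ> c) V ` V = {1..card S}"
      proof -
        have "restrict (h \<circ> c) V ` V = h ` (c ` V)" by (simp add: image_comp)
        with c hS show ?thesis by simp
      qed
      moreover have "restrict (h \<circ> c) V \<in> V \<rightarrow>\<^sub>E {1..card S}"
        using im by (auto simp del: atLeastAtMost_iff)
      moreover have "restrict (h \<circ> c) V u \<noteq> restrict (h \<circ> c) V v" if e: "(u, v) \<in> parcs H" for u v
      proof -
        have "c u \<in> S" "c v \<in> S" "c u \<noteq> c v"
          using c e wf[OF e] by (auto simp: proper_colorings_def)
        then have "h (c u) \<noteq> h (c v)" using gh by metis
        then show ?thesis using wf[OF e] by simp
      qed
      ultimately show "restrict (h \<circ> c) V \<in> ?B"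
        unfolding proper_colorings_def V_def by blast
    qed
    show "(\<lambda>c. restrict (?g \<circ> c) V) \<in> ?B \<rightarrow> ?A"
    proof
      fix c assume c: "c \<in> ?B"
      have im: "restrict (?g \<circ> c) V ` V = S"
      proof -
        have "restrict (?g \<circ> c) V ` V = ?g ` (c ` V)" by (simp add: image_comp)
        with c gS show ?thesis by simp
      qed
      moreover have "restrict (?g \<circ> c) V \<in> V \<rightarrow>\<^sub>E {1..x}"
        using im assms(2) by (auto simp del: atLeastAtMost_iff)
      moreover have "restrict (?g \<circ> c) V u \<noteq> restrict (?g \<circ> c) V v" if e: "(u, v) \<in> parcs H" for u v
      proof -
        have "c u \<in> {1..card S}" "c v \<in> {1..card S}" "c u \<noteq> c v"
          using c e wf[OF e] by (auto simp: proper_colorings_def simp del: atLeastAtMost_iff)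
        then have "?g (c u) \<noteq> ?g (c v)" using hg by metis
        then show ?thesis using wf[OF e] by simp
      qed
      ultimately show "restrict (?g \<circ> c) V \<in> ?A"
        unfolding proper_colorings_def V_def by blast
    qed
    show "restrict (?g \<circ> restrict (h \<circ> c) V) V = c" if c: "c \<in> ?A" for c
    proof
      fix v show "restrict (?g \<circ> restrict (h \<circ> c) V) V v = c v"
        using c gh by (auto simp: proper_colorings_def V_def PiE_def extensional_def)
    qed
    show "restrict (h \<circ> restrict (?g \<circ> c) V) V = c" if c: "c \<in> ?B" for c
    proof
      fix v
      have "c v \<in> {1..card S}" if "v \<in> V" using c that by blast
      then show "restrict (h \<circ> restrict (?g \<circ> c) V) V v = c v"
        using c hg by (auto simp: proper_colorings_def V_def PiE_def extensional_def)
    qed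
  qed
  then show ?thesis unfolding V_def by (rule bij_betw_same_card)
qed

lemma finite_proper_colorings: "finite (pverts H) \<Longrightarrow> finite (proper_colorings H x)"
  unfolding proper_colorings_def by (rule finite_subset[of _ "pverts H \<rightarrow>\<^sub>E {1..x}"])
    (auto intro!: finite_PiE)

lemma card_proper_colorings:
  assumes "pair_wf_digraph H" "finite (pverts H)"
  shows "card (proper_colorings H x) =
         (\<Sum>j\<le>card (pverts H). (x choose j) * card {c \<in> proper_colorings H j. c ` pverts H = {1..j}})"
proof -
  define V where "V = pverts H"
  define a where "a j = card {c \<in> proper_colorings H j. c ` V = {1..j}}" for j
  have a0: "a j = 0" if "j > card V" for j
  proof -
    have "{c \<in> proper_colorings H j. c ` V = {1..j}} = {}"
    proof (rule equals0I)
      fix c assume "c \<in> {c \<in> proper_colorings H j. c ` V = {1..j}}"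
      then have "j = card (c ` V)" by simp
      also have "\<dots> \<le> card V" using assms(2) V_def by (auto intro: card_image_le)
      finally show False using that by simp
    qed
    then show ?thesis unfolding a_def by (metis card.empty)
  qed
  have "proper_colorings H x = (\<Union>S\<in>Pow {1..x}. {c \<in> proper_colorings H x. c ` V = S})"
    by (auto simp: proper_colorings_def V_def PiE_def Pi_def)
  then have "card (proper_colorings H x) =
      card (\<Union>S\<in>Pow {1..x}. {c \<in> proper_colorings H x. c ` V = S})"
    by (rule arg_cong)
  also have "\<dots> = (\<Sum>S\<in>Pow {1..x}. card {c \<in> proper_colorings H x. c ` V = S})"
    by (rule card_UN_disjoint) (auto intro: finite_subset[OF _ finite_proper_colorings[OF assms(2)]])
  also have "\<dots> = (\<Sum>S\<in>Pow {1..x}. a (card S))"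
    unfolding a_def V_def by (intro sum.cong refl card_onto_colorings[OF assms(1)]) (rule PowD)
  also have "\<dots> = (\<Sum>j\<le>x. \<Sum>S\<in>{S \<in> Pow {1..x}. card S = j}. a (card S))"
  proof (rule sum.group[symmetric])
    show "card ` Pow {1..x} \<subseteq> {..x}"
    proof
      fix j assume "j \<in> card ` Pow {1..x}"
      then obtain S where "S \<subseteq> {1..x}" "j = card S" by auto
      then show "j \<in> {..x}" using card_mono[of "{1..x}" S] by simp
    qed
  qed auto
  also have "\<dots> = (\<Sum>j\<le>x. (x choose j) * a j)"
  proof (rule sum.cong[OF refl])
    fix j
    have "(\<Sum>S\<in>{S \<in> Pow {1..x}. card S = j}. a (card S)) = (\<Sum>S\<in>{S. S \<subseteq> {1..x} \<and> card S = j}. a j)"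
      by (intro sum.cong) auto
    also have "\<dots> = (x choose j) * a j" by (simp add: n_subsets)
    finally show "(\<Sum>S\<in>{S \<in> Pow {1..x}. card S = j}. a (card S)) = (x choose j) * a j" .
  qed
  also have "\<dots> = (\<Sum>j\<le>max x (card V). (x choose j) * a j)"
    by (rule sum.mono_neutral_left) auto
  also have "\<dots> = (\<Sum>j\<le>card V. (x choose j) * a j)"
    by (rule sum.mono_neutral_right) (auto simp: a0)
  finally show ?thesis unfolding a_def V_def .
qed

lemma chromatic_poly_ex1:
  assumes "pair_wf_digraph H" "finite (pverts H)"
  shows "\<exists>!P :: real poly. \<forall>x::nat. x > 0 \<longrightarrow> poly P (real x) = real (card (proper_colorings H x))"
proof (rule ex_ex1I)
  let ?a = "\<lambda>j. card {c \<in> proper_colorings H j. c ` pverts H = {1..j}}"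
  let ?P = "\<Sum>j\<le>card (pverts H). smult (real (?a j) / fact j) (\<Prod>i<j. [:- real i, 1:])"
  have "poly ?P (real x) = real (card (proper_colorings H x))" for x
    unfolding card_proper_colorings[OF assms]
    by (simp add: poly_sum poly_prod binomial_gbinomial gbinomial_prod_rev atLeast0LessThan mult.commute)
  then show "\<exists>P. \<forall>x::nat. x > 0 \<longrightarrow> poly P (real x) = real (card (proper_colorings H x))" by blast
next
  fix P Q :: "real poly"
  assume "\<forall>x::nat. x > 0 \<longrightarrow> poly P (real x) = real (card (proper_colorings H x))"
    and "\<forall>x::nat. x > 0 \<longrightarrow> poly Q (real x) = real (card (proper_colorings H x))"
  then have "real ` {0<..} \<subseteq> {z. poly (P - Q) z = 0}" by auto
  moreover have "infinite (real ` {0<..})"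
    by (simp add: finite_image_iff infinite_Ioi)
  ultimately have "infinite {z. poly (P - Q) z = 0}" using finite_subset by blast
  then have "P - Q = 0" using poly_roots_finite by blast
  then show "P = Q" by simp
qed

lemma poly_chromatic_poly:
  assumes "pair_wf_digraph H" "finite (pverts H)" "x > 0"
  shows "poly (chromatic_poly H) (real x) = real (card (proper_colorings H x))"
  using theI'[OF chromatic_poly_ex1[OF assms(1,2)]] assms(3) unfolding chromatic_poly_def by blast

lemma finite_cube: "finite (cube n :: (int ^ 's) set)"
proof -
  have "(cube n :: (int ^ 's) set) \<subseteq> vec_lambda ` (UNIV \<rightarrow>\<^sub>E {1..int n})"
  proof
    fix X :: "int ^ 's" assume "X \<in> cube n"
    then have "vec_nth X \<in> UNIV \<rightarrow>\<^sub>E {1..int n}" by (auto simp: cube_def)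
    then show "X \<in> vec_lambda ` (UNIV \<rightarrow>\<^sub>E {1..int n})"
      by (metis image_eqI vec_nth_inverse)
  qed
  then show ?thesis by (rule finite_subset) (auto intro!: finite_imageI finite_PiE)
qed

lemma cube_nonempty: "n > 0 \<Longrightarrow> (cube n :: (int ^ 's) set) \<noteq> {}"
  by (auto simp: cube_def intro!: exI[of _ "\<chi> i. 1"])

end

theory Submission
  imports Defs
begin

text \<open>
  Two points are mutually visible iff they are incongruent modulo every prime, so a tuple is
  \<open>H\<close>-visible iff its reduction modulo each prime \<open>p\<close> is a proper coloring of \<open>H\<close> with the \<open>p\<^sup>s\<close>
  residue classes as colors. By the Chinese remainder theorem and periodicity, the density of the
  tuples passing this test for all \<open>p \<le> N\<close> is the partial product of \<open>P\<^sub>H(p\<^sup>s) / p\<^sup>k\<^sup>s\<close> over \<open>p \<le> N\<close>.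
  The tuples failing it only at primes above \<open>N\<close> have density at most
  \<open>\<Sum>\<^bsub>d > N\<^esub> (2 / d)\<^sup>s = O(1 / N)\<close> for each edge, uniformly in \<open>n\<close>. Note that \<open>cube m\<close> is a complete
  system of residues modulo \<open>m\<close>.
\<close>

section \<open>Congruence of lattice points and visibility\<close>

definition vec_cong :: "nat \<Rightarrow> int ^ 's \<Rightarrow> int ^ 's \<Rightarrow> bool" where
  "vec_cong m X Y \<longleftrightarrow> (\<forall>i. int m dvd X $ i - Y $ i)"

lemma vec_cong_refl [simp]: "vec_cong m X X"
  by (simp add: vec_cong_def)

lemma vec_cong_iff_mod: "vec_cong m X Y \<longleftrightarrow> (\<forall>i. X $ i mod int m = Y $ i mod int m)"
  by (simp add: vec_cong_def mod_eq_dvd_iff)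

lemma vec_cong_replace:
  assumes "vec_cong m X X'" "vec_cong m Y Y'"
  shows "vec_cong m X Y \<longleftrightarrow> vec_cong m X' Y'"
  using assms by (simp add: vec_cong_iff_mod)

lemma vec_cong_dvd_modulus: "vec_cong m X Y \<Longrightarrow> d dvd m \<Longrightarrow> vec_cong d X Y"
  unfolding vec_cong_def by (meson dvd_trans int_dvd_int_iff)

lemma vec_cong_mult:
  assumes "vec_cong a X Y" "vec_cong b X Y" "coprime a b"
  shows "vec_cong (a * b) X Y"
  using assms unfolding vec_cong_def by (simp add: divides_mult)

text \<open>Coordinates of two points of \<open>cube n\<close> differ by less than \<open>n\<close>,
  so a difference divisible by \<open>m\<close>, which is at least \<open>n\<close>, must
  vanish.\<close>

lemma cube_vec_cong_eq:
  assumes "X \<in> cube n" "Y \<in> cube n" "vec_cong m X Y" "n \<le> m"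
  shows "X = Y"
proof -
  have "X $ i = Y $ i" for i
  proof (rule ccontr)
    assume "X $ i \<noteq> Y $ i"
    moreover have "int m dvd X $ i - Y $ i" using assms(3) by (simp add: vec_cong_def)
    ultimately have "int m \<le> \<bar>X $ i - Y $ i\<bar>"
      by (metis abs_of_nat dvd_imp_le_int eq_iff_diff_eq_0)
    moreover have "\<bar>X $ i - Y $ i\<bar> < int n"
      using assms(1,2)[unfolded cube_def mem_Collect_eq, rule_format, of i] by auto
    ultimately show False using assms(4) by linarith
  qed
  then show ?thesis by (simp add: vec_eq_iff)
qed

lemma card_vec_coordinates:
  fixes A :: "'s::finite \<Rightarrow> 'b set"
  shows "card {X :: 'b ^ 's. \<forall>i. X $ i \<in> A i} = (\<Prod>i\<in>UNIV. card (A i))"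
proof -
  have "bij_betw vec_nth {X :: 'b ^ 's. \<forall>i. X $ i \<in> A i} (PiE UNIV A)"
    by (rule bij_betwI[where g = vec_lambda]) auto
  then show ?thesis by (simp add: bij_betw_same_card card_PiE)
qed

lemma card_cube: "card (cube n :: (int ^ 's::finite) set) = n ^ CARD('s)"
  unfolding cube_def by (simp add: card_vec_coordinates del: atLeastAtMost_iff)

text \<open>If a prime p divides all coordinates of X - Y, cutting the segment into p equal pieces
  yields further lattice points on it. Conversely, a lattice point at parameter t of the segment has
  t rational, as seen in a coordinate where X and Y differ. Writing t = a/b in lowest terms, b
  divides every coordinate of Y - X. So b has no prime factor, hence b = 1, and t is 0 or 1.\<close>

lemma mutually_visible_iff:
  fixes X Y :: "int ^ 's::finite"
  shows "mutually_visible X Y \<longleftrightarrow> (\<forall>p. prime p \<longrightarrow> \<not> vec_cong p X Y)"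
proof
  assume vis: "mutually_visible X Y"
  show "\<forall>p. prime p \<longrightarrow> \<not> vec_cong p X Y"
  proof (intro allI impI notI)
    fix p :: nat assume p: "prime p" and cong: "vec_cong p X Y"
    \<comment> \<open>The lattice point one p-th of the way from Y to X.\<close>
    define Z where "Z = (\<chi> i. Y $ i + (X $ i - Y $ i) div int p)"
    have Z: "int p * (Z $ i - Y $ i) = X $ i - Y $ i" for i
      using cong by (simp add: Z_def vec_cong_def)
    have p1: "real p > 1" using prime_gt_1_nat[OF p] by simp
    obtain i where i: "X $ i \<noteq> Y $ i"
      using vis unfolding mutually_visible_def vec_eq_iff by blast
    have "Z \<noteq> Y" using Z[of i] i by auto
    moreover have "Z \<noteq> X"
    proof
      assume "Z = X"
      then have "int p * (X $ i - Y $ i) = 1 * (X $ i - Y $ i)" using Z[of i] by simp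
      then show False using i p1 by (simp del: mult_1)
    qed
    moreover have "real_vec Z \<in> closed_segment (real_vec X) (real_vec Y)"
      unfolding in_segment
    \<comment> \<open>The parameter of the segment is measured from X, so it is the complement of
      1/p.\<close>
    proof (intro exI[of _ "1 - 1 / real p"] conjI)
      have "real p * (real_of_int (Z $ i) - real_of_int (Y $ i)) = real_of_int (X $ i) - real_of_int (Y $ i)" for i
        using arg_cong[OF Z[of i], of real_of_int] by simp
      then have "real_of_int (Z $ i) = (1 - (1 - 1 / real p)) * real_of_int (X $ i)
          + (1 - 1 / real p) * real_of_int (Y $ i)" for i
        using p1 by (simp add: field_simps)
      then show "real_vec Z = (1 - (1 - 1 / real p)) *\<^sub>R real_vec X + (1 - 1 / real p) *\<^sub>R real_vec Y"
        by (simp add: real_vec_def vec_eq_iff)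
    qed (use p1 in auto)
    ultimately show False using vis unfolding mutually_visible_def by blast
  qed
next
  assume nc: "\<forall>p. prime p \<longrightarrow> \<not> vec_cong p X Y"
  have neq: "X \<noteq> Y" using nc two_is_prime_nat by auto
  show "mutually_visible X Y"
    unfolding mutually_visible_def
  proof (intro conjI neq allI impI)
    fix Z assume "real_vec Z \<in> closed_segment (real_vec X) (real_vec Y)"
    then obtain t where t: "0 \<le> t" "t \<le> 1"
      and Zt: "real_vec Z = (1 - t) *\<^sub>R real_vec X + t *\<^sub>R real_vec Y"
      unfolding in_segment by blast
    have tZ: "t * real_of_int (Y $ i - X $ i) = real_of_int (Z $ i - X $ i)" for i
      using arg_cong[OF Zt, of "\<lambda>v. v $ i"] by (simp add: real_vec_def algebra_simps)
    obtain i where i: "X $ i \<noteq> Y $ i" using neq unfolding vec_eq_iff by blast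
    have "t = real_of_int (Z $ i - X $ i) / real_of_int (Y $ i - X $ i)"
      using tZ[of i] i by (simp add: field_simps)
    then have "t \<in> \<rat>" by (simp only: Rats_divide Rats_of_int)
    then obtain a b :: nat where b: "b \<noteq> 0" and ab: "\<bar>t\<bar> = real a / real b" "coprime a b"
      by (rule Rats_abs_nat_div_natE)
    have "int b dvd Y $ j - X $ j" for j
    proof -
      have "real a * real_of_int (Y $ j - X $ j) = real b * real_of_int (Z $ j - X $ j)"
      proof -
        have "real a = real b * t" using ab(1) t(1) b by (simp add: field_simps)
        then show ?thesis by (simp only: mult.assoc tZ)
      qed
      then have "real_of_int (int a * (Y $ j - X $ j)) = real_of_int (int b * (Z $ j - X $ j))"
        by simp
      then have "int a * (Y $ j - X $ j) = int b * (Z $ j - X $ j)"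
        by (simp only: of_int_eq_iff)
      then have "int b dvd int a * (Y $ j - X $ j)" by simp
      then show ?thesis
        using ab(2) by (simp add: coprime_dvd_mult_right_iff coprime_commute)
    qed
    then have "vec_cong b X Y" by (simp add: vec_cong_def dvd_diff_commute)
    then have "b = 1"
      using nc vec_cong_dvd_modulus prime_factor_nat by blast
    then have "a = 0 \<or> a = 1" using ab(1) t by (simp add: le_Suc_eq)
    then have "t = 0 \<or> t = 1" using ab(1) t(1) \<open>b = 1\<close> by auto
    then have "real_vec Z = real_vec X \<or> real_vec Z = real_vec Y" using Zt by auto
    then show "Z = X \<or> Z = Y" by (auto simp: real_vec_def vec_eq_iff)
  qed
qed

section \<open>Residues, quotients and product decompositions of tuples\<close>

lemma card_PiE_cube:
  "finite K \<Longrightarrow> card (K \<rightarrow>\<^sub>E (cube n :: (int ^ 's::finite) set)) = n ^ (card K * CARD('s))"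
  by (simp add: card_PiE card_cube power_mult[symmetric] mult.commute)

text \<open>Injectivity passes from points to tuples, and both sides have equally many elements, so
  surjectivity needs no construction. This covers two cases: residues modulo coprime
  \<open>a\<close> and \<open>b\<close> (Chinese remainder theorem), and residue and quotient in a
  division by \<open>a\<close>.\<close>

lemma bij_betw_PiE_cube_mult:
  fixes \<alpha> \<beta> :: "int ^ 's::finite \<Rightarrow> int ^ 's"
  assumes "finite K" "\<alpha> \<in> cube (a * b) \<rightarrow> cube a" "\<beta> \<in> cube (a * b) \<rightarrow> cube b"
    and inj: "\<And>x y. x \<in> cube (a * b) \<Longrightarrow> y \<in> cube (a * b) \<Longrightarrow> \<alpha> x = \<alpha> y \<Longrightarrow> \<beta> x = \<beta> y \<Longrightarrow> x = y"
  shows "bij_betw (\<lambda>X. (restrict (\<alpha> \<circ> X) K, restrict (\<beta> \<circ> X) K))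
           (K \<rightarrow>\<^sub>E cube (a * b)) ((K \<rightarrow>\<^sub>E cube a) \<times> (K \<rightarrow>\<^sub>E cube b))"
    (is "bij_betw ?f ?A ?B")
proof -
  have fin: "finite ?B" using assms(1) by (auto intro!: finite_PiE finite_cube)
  have "inj_on ?f ?A"
  proof (rule inj_onI)
    fix X Y assume X: "X \<in> ?A" and Y: "Y \<in> ?A" and eq: "?f X = ?f Y"
    show "X = Y"
    proof (rule PiE_ext[OF X Y])
      fix u assume u: "u \<in> K"
      have "\<alpha> (X u) = \<alpha> (Y u)" "\<beta> (X u) = \<beta> (Y u)"
        using fun_cong[of _ _ u] eq u by (fastforce dest: fun_cong[of _ _ u])+
      then show "X u = Y u" using inj X Y u by (meson PiE_mem)
    qed
  qed
  moreover have "?f ` ?A = ?B"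
  proof (rule card_subset_eq[OF fin])
    show "?f ` ?A \<subseteq> ?B" using assms(2,3) by (auto simp: PiE_iff Pi_iff)
    show "card (?f ` ?A) = card ?B"
      using \<open>inj_on ?f ?A\<close> assms(1)
      by (simp add: card_image card_cartesian_product card_PiE_cube power_mult_distrib)
  qed
  ultimately show ?thesis by (simp add: bij_betw_def)
qed

text \<open>The shift by 1 makes the representatives run through 1, ..., m, the coordinates
  occurring in \<open>cube m\<close>, instead of 0, ..., m - 1.\<close>

definition cube_mod :: "nat \<Rightarrow> int ^ 's \<Rightarrow> int ^ 's" where
  "cube_mod m X = (\<chi> i. (X $ i - 1) mod int m + 1)"

lemma vec_cong_cube_mod: "vec_cong m (cube_mod m X) X"
  by (auto simp: vec_cong_iff_mod cube_mod_def mod_simps)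

lemma cube_mod_in_cube: "m > 0 \<Longrightarrow> cube_mod m X \<in> cube m"
  by (simp add: cube_def cube_mod_def add1_zle_eq)

lemma cube_mod_eq_iff:
  assumes "m > 0"
  shows "cube_mod m X = cube_mod m Y \<longleftrightarrow> vec_cong m X Y"
  by (simp add: cube_mod_def vec_eq_iff vec_cong_def mod_eq_dvd_iff)

text \<open>A condition that splits into one condition per component cuts out a product of subsets.
  Both multiplicativity and periodicity of the sieve counts are instances.\<close>

lemma card_bij_betw_Times:
  assumes "bij_betw f A (B \<times> C)"
    and "\<And>x. x \<in> A \<Longrightarrow> R x \<longleftrightarrow> P (fst (f x)) \<and> Q (snd (f x))"
  shows "card {x \<in> A. R x} = card {x \<in> B. P x} * card {x \<in> C. Q x}"
proof -
  have "f ` {x \<in> A. R x} = {x \<in> B \<times> C. P (fst x) \<and> Q (snd x)}"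
  proof (intro equalityI subsetI)
    fix y assume "y \<in> {x \<in> B \<times> C. P (fst x) \<and> Q (snd x)}"
    then have y: "y \<in> f ` A" "P (fst y)" "Q (snd y)"
      using bij_betw_imp_surj_on[OF assms(1)] by auto
    then obtain x where "x \<in> A" "y = f x" by blast
    then show "y \<in> f ` {x \<in> A. R x}" using y assms(2) by auto
  qed (use assms bij_betwE in blast)
  also have "\<dots> = {x \<in> B. P x} \<times> {x \<in> C. Q x}" by auto
  finally have "bij_betw f {x \<in> A. R x} ({x \<in> B. P x} \<times> {x \<in> C. Q x})"
    using bij_betw_subset[OF assms(1), of "{x \<in> A. R x}"] by auto
  then show ?thesis by (simp add: bij_betw_same_card card_cartesian_product)
qed

section \<open>The sieve and its local counts\<close>

definition sieve :: "('a \<times> 'a) set \<Rightarrow> nat \<Rightarrow> ('a \<Rightarrow> int ^ 's) \<Rightarrow> bool" where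
  "sieve E m X \<longleftrightarrow> (\<forall>p. prime p \<longrightarrow> p dvd m \<longrightarrow> (\<forall>(u, v)\<in>E. \<not> vec_cong p (X u) (X v)))"

text \<open>Modulus \<open>m\<close> and side \<open>n\<close> are kept apart: \<open>n = m\<close>
  counts residue classes, while fixed \<open>m\<close> and growing \<open>n\<close> give a
  density.\<close>

definition sifted :: "'a set \<Rightarrow> ('a \<times> 'a) set \<Rightarrow> nat \<Rightarrow> nat \<Rightarrow> ('a \<Rightarrow> int ^ 's) set" where
  "sifted K E m n = {X \<in> K \<rightarrow>\<^sub>E cube n. sieve E m X}"

lemma sieve_mult: "sieve E (a * b) X \<longleftrightarrow> sieve E a X \<and> sieve E b X"
  unfolding sieve_def using prime_dvd_mult_iff by blast

text \<open>The primes tested divide \<open>m\<close>, so they only see residues modulo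
  \<open>m\<close>. Arcs must stay inside \<open>K\<close>, because the restricted tuple is
  \<open>undefined\<close> elsewhere.\<close>

lemma sieve_cube_mod:
  assumes "E \<subseteq> K \<times> K"
  shows "sieve E m (restrict (cube_mod m \<circ> X) K) \<longleftrightarrow> sieve E m X"
proof -
  have "vec_cong p (restrict (cube_mod m \<circ> X) K u) (restrict (cube_mod m \<circ> X) K v) \<longleftrightarrow>
      vec_cong p (X u) (X v)" if "p dvd m" "(u, v) \<in> E" for p u v
  proof -
    have "u \<in> K" "v \<in> K" using that assms by auto
    then show ?thesis
      using vec_cong_replace[OF vec_cong_dvd_modulus[OF vec_cong_cube_mod that(1)]
          vec_cong_dvd_modulus[OF vec_cong_cube_mod that(1)]] by simp
  qed
  then show ?thesis unfolding sieve_def by blast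
qed

text \<open>Chinese remainder theorem: a tuple modulo \<open>a * b\<close> is a pair of tuples
  modulo \<open>a\<close> and modulo \<open>b\<close>, and each prime divisor of
  \<open>a * b\<close> tests one of the two.\<close>

lemma card_sifted_mult:
  assumes "finite K" "E \<subseteq> K \<times> K" "a > 0" "b > 0" "coprime a b"
  shows "card (sifted K E (a * b) (a * b) :: ('a \<Rightarrow> int ^ 's::finite) set) =
         card (sifted K E a a :: ('a \<Rightarrow> int ^ 's) set) * card (sifted K E b b :: ('a \<Rightarrow> int ^ 's) set)"
  unfolding sifted_def
proof (rule card_bij_betw_Times)
  show "bij_betw (\<lambda>X :: 'a \<Rightarrow> int ^ 's. (restrict (cube_mod a \<circ> X) K, restrict (cube_mod b \<circ> X) K))
      (K \<rightarrow>\<^sub>E cube (a * b)) ((K \<rightarrow>\<^sub>E cube a) \<times> (K \<rightarrow>\<^sub>E cube b))"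
    using assms by (intro bij_betw_PiE_cube_mult)
      (auto intro: cube_mod_in_cube cube_vec_cong_eq vec_cong_mult simp: cube_mod_eq_iff)
qed (simp add: sieve_mult sieve_cube_mod assms(2))

text \<open>Index of the block of side \<open>m\<close> containing the point. Indices start at 1, so
  that the blocks of \<open>cube (m * q)\<close> are indexed by the points of
  \<open>cube q\<close>.\<close>

definition cube_div :: "nat \<Rightarrow> int ^ 's \<Rightarrow> int ^ 's" where
  "cube_div m X = (\<chi> i. (X $ i - 1) div int m + 1)"

lemma cube_div_in_cube:
  assumes "m > 0" "X \<in> cube (m * q)"
  shows "cube_div m X \<in> cube q"
proof -
  have "0 \<le> (X $ i - 1) div int m \<and> (X $ i - 1) div int m < int q" for i
  proof -
    have "0 \<le> X $ i - 1" "X $ i - 1 < int q * int m"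
      using assms(2)[unfolded cube_def mem_Collect_eq, rule_format, of i] by (auto simp: mult.commute)
    moreover have "(X $ i - 1) div int m * int m \<le> X $ i - 1"
      using div_mult_mod_eq[of "X $ i - 1" "int m"] pos_mod_sign[of "int m" "X $ i - 1"] assms(1) by linarith
    ultimately have "(X $ i - 1) div int m * int m < int q * int m" by linarith
    then show ?thesis
      using assms(1) \<open>0 \<le> X $ i - 1\<close> by (simp add: pos_imp_zdiv_nonneg_iff)
  qed
  then show ?thesis by (simp add: cube_def cube_div_def add1_zle_eq)
qed

lemma cube_mod_div_eqI:
  assumes "cube_mod m X = cube_mod m Y" "cube_div m X = cube_div m Y"
  shows "X = Y"
proof -
  have "X $ i - 1 = Y $ i - 1" for i
  proof -
    have "(X $ i - 1) mod int m = (Y $ i - 1) mod int m" "(X $ i - 1) div int m = (Y $ i - 1) div int m"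
      using assms by (simp_all add: cube_mod_def cube_div_def vec_eq_iff)
    then show ?thesis by (metis div_mult_mod_eq)
  qed
  then show ?thesis by (simp add: vec_eq_iff)
qed

text \<open>Periodicity: the sieve constrains only the residues modulo \<open>m\<close>, so the
  block indices of the points are free.\<close>

lemma card_sifted_scale:
  assumes "finite K" "E \<subseteq> K \<times> K" "m > 0"
  shows "card (sifted K E m (m * q) :: ('a \<Rightarrow> int ^ 's::finite) set) =
         card (sifted K E m m :: ('a \<Rightarrow> int ^ 's) set) * q ^ (card K * CARD('s))"
proof -
  have "card (sifted K E m (m * q) :: ('a \<Rightarrow> int ^ 's::finite) set) =
      card (sifted K E m m :: ('a \<Rightarrow> int ^ 's) set) * card {X \<in> K \<rightarrow>\<^sub>E (cube q :: (int ^ 's) set). True}"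
    unfolding sifted_def
  proof (rule card_bij_betw_Times)
    show "bij_betw (\<lambda>X :: 'a \<Rightarrow> int ^ 's. (restrict (cube_mod m \<circ> X) K, restrict (cube_div m \<circ> X) K))
        (K \<rightarrow>\<^sub>E cube (m * q)) ((K \<rightarrow>\<^sub>E cube m) \<times> (K \<rightarrow>\<^sub>E cube q))"
      using assms by (intro bij_betw_PiE_cube_mult)
        (auto intro: cube_mod_in_cube cube_div_in_cube cube_mod_div_eqI)
  qed (simp add: sieve_cube_mod assms(2))
  then show ?thesis by (simp add: card_PiE_cube assms(1))
qed

lemma card_sifted_primes:
  assumes "finite K" "E \<subseteq> K \<times> K" "finite S" "\<And>p. p \<in> S \<Longrightarrow> prime p"
  shows "card (sifted K E (\<Prod>S) (\<Prod>S) :: ('a \<Rightarrow> int ^ 's::finite) set) =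
         (\<Prod>p\<in>S. card (sifted K E p p :: ('a \<Rightarrow> int ^ 's) set))"
  using assms(3,4)
proof (induction S rule: finite_induct)
  case empty
  \<comment> \<open>No prime divides 1, and \<open>cube 1\<close> is a single point, so the count
    agrees with the empty product.\<close>
  have "sifted K E 1 1 = (K \<rightarrow>\<^sub>E cube 1 :: ('a \<Rightarrow> int ^ 's) set)"
    by (auto simp: sifted_def sieve_def)
  then show ?case by (simp add: card_PiE_cube assms(1))
next
  case (insert p S)
  have "coprime p (\<Prod>S)"
    using insert by (intro prod_coprime_right primes_coprime) auto
  moreover have "\<Prod>S > 0" "p > 0" using insert by (auto intro!: prod_pos prime_gt_0_nat)
  ultimately show ?case using insert assms(1,2) by (simp add: card_sifted_mult)
qed

text \<open>Within \<open>cube p\<close> congruence modulo p is equality. A sifted tuple is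
  therefore a proper coloring whose colors are the p^s points of \<open>cube p\<close>, and any
  enumeration \<open>h\<close> of these points turns it into a coloring by numbers.\<close>

lemma card_sifted_prime:
  assumes "pair_wf_digraph H" "prime p"
  shows "card (sifted (pverts H) (parcs H) p p :: ('a \<Rightarrow> int ^ 's::finite) set) =
         card (proper_colorings H (p ^ CARD('s)))"
proof -
  define V where "V = pverts H"
  have wf: "u \<in> V" "v \<in> V" if "(u, v) \<in> parcs H" for u v
    using pair_wf_digraph.in_arcsD1[OF assms(1) that] pair_wf_digraph.in_arcsD2[OF assms(1) that]
    by (auto simp: V_def)
  let ?C = "{1..p ^ CARD('s)}"
  obtain h where h: "bij_betw h (cube p :: (int ^ 's) set) ?C"
    using finite_same_card_bij[OF finite_cube, of ?C p] by (auto simp: card_cube)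
  define g where "g = inv_into (cube p) h"
  have g: "bij_betw g ?C (cube p)" unfolding g_def using h by (rule bij_betw_inv_into)
  have hg: "h (g i) = i" if "i \<in> ?C" for i
    using h that unfolding g_def by (simp add: bij_betw_inv_into_right)
  have gh: "g (h x) = x" if "x \<in> cube p" for x
    using h that unfolding g_def by (simp add: bij_betw_inv_into_left)
  have hC: "h x \<in> ?C" if "x \<in> cube p" for x using h that by (rule bij_betwE[rule_format])
  have gC: "g i \<in> cube p" if "i \<in> ?C" for i using g that by (rule bij_betwE[rule_format])
  have sieve: "sieve (parcs H) p X \<longleftrightarrow> (\<forall>(u, v)\<in>parcs H. X u \<noteq> X v)"
    if X: "X \<in> V \<rightarrow>\<^sub>E (cube p :: (int ^ 's) set)" for X
  proof -
    have "vec_cong p (X u) (X v) \<longleftrightarrow> X u = X v" if e: "(u, v) \<in> parcs H" for u v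
      using cube_vec_cong_eq[of "X u" p "X v" p] PiE_mem[OF X] wf[OF e] by auto
    then have "(\<forall>(u, v)\<in>parcs H. \<not> vec_cong p (X u) (X v)) \<longleftrightarrow> (\<forall>(u, v)\<in>parcs H. X u \<noteq> X v)"
      by blast
    moreover have "sieve (parcs H) p X \<longleftrightarrow> (\<forall>(u, v)\<in>parcs H. \<not> vec_cong p (X u) (X v))"
      unfolding sieve_def by (metis assms(2) dvd_refl primes_dvd_imp_eq)
    ultimately show ?thesis by simp
  qed
  have "bij_betw (\<lambda>X. restrict (h \<circ> X) V) (sifted V (parcs H) p p) (proper_colorings H (p ^ CARD('s)))"
  proof (rule bij_betwI[where g = "\<lambda>c. restrict (g \<circ> c) V"])
    show "(\<lambda>X. restrict (h \<circ> X) V) \<in> sifted V (parcs H) p p \<rightarrow> proper_colorings H (p ^ CARD('s))"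
    proof
      fix X :: "'a \<Rightarrow> int ^ 's" assume *: "X \<in> sifted V (parcs H) p p"
      then have X: "X \<in> V \<rightarrow>\<^sub>E cube p" by (simp add: sifted_def)
      have ne: "\<forall>(u, v)\<in>parcs H. X u \<noteq> X v"
        using * sieve[OF X] unfolding sifted_def by blast
      have "restrict (h \<circ> X) V u \<noteq> restrict (h \<circ> X) V v" if e: "(u, v) \<in> parcs H" for u v
      proof -
        have "X u \<noteq> X v" using ne e by blast
        then have "h (X u) \<noteq> h (X v)"
          using gh[OF PiE_mem[OF X wf(1)[OF e]]] gh[OF PiE_mem[OF X wf(2)[OF e]]] by metis
        then show ?thesis using wf[OF e] by simp
      qed
      moreover have "restrict (h \<circ> X) V \<in> V \<rightarrow>\<^sub>E ?C"
        using hC PiE_mem[OF X] by (simp add: PiE_iff del: atLeastAtMost_iff)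
      ultimately show "restrict (h \<circ> X) V \<in> proper_colorings H (p ^ CARD('s))"
        unfolding proper_colorings_def V_def by blast
    qed
    show "(\<lambda>c. restrict (g \<circ> c) V) \<in> proper_colorings H (p ^ CARD('s)) \<rightarrow> sifted V (parcs H) p p"
    proof
      fix c assume "c \<in> proper_colorings H (p ^ CARD('s))"
      then have c: "c \<in> V \<rightarrow>\<^sub>E ?C" and ne: "\<forall>(u, v)\<in>parcs H. c u \<noteq> c v"
        unfolding proper_colorings_def V_def by auto
      have "restrict (g \<circ> c) V u \<noteq> restrict (g \<circ> c) V v" if e: "(u, v) \<in> parcs H" for u v
      proof -
        have "c u \<noteq> c v" using ne e by blast
        then have "g (c u) \<noteq> g (c v)"
          using hg[OF PiE_mem[OF c wf(1)[OF e]]] hg[OF PiE_mem[OF c wf(2)[OF e]]] by metis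
        then show ?thesis using wf[OF e] by simp
      qed
      moreover have "restrict (g \<circ> c) V \<in> V \<rightarrow>\<^sub>E cube p"
        using gC PiE_mem[OF c] by (simp add: PiE_iff del: atLeastAtMost_iff)
      ultimately show "restrict (g \<circ> c) V \<in> sifted V (parcs H) p p"
        using sieve unfolding sifted_def by blast
    qed
    show "restrict (g \<circ> restrict (h \<circ> X) V) V = X" if "X \<in> sifted V (parcs H) p p" for X
    proof -
      have X: "X \<in> V \<rightarrow>\<^sub>E cube p" using that by (simp add: sifted_def)
      show ?thesis
        using X gh by (intro PiE_ext[OF _ X]) (auto simp: PiE_iff)
    qed
    show "restrict (h \<circ> restrict (g \<circ> c) V) V = c" if "c \<in> proper_colorings H (p ^ CARD('s))" for c
    proof -
      have c: "c \<in> V \<rightarrow>\<^sub>E ?C" using that by (simp add: proper_colorings_def V_def)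
      show ?thesis
        using c hg by (intro PiE_ext[OF _ c]) (auto simp: PiE_iff simp del: atLeastAtMost_iff)
    qed
  qed
  then show ?thesis unfolding V_def by (rule bij_betw_same_card)
qed

section \<open>Densities of sifted tuples\<close>

lemma finite_PiE_cube: "finite K \<Longrightarrow> finite (K \<rightarrow>\<^sub>E (cube n :: (int ^ 's::finite) set))"
  by (intro finite_PiE finite_cube)

lemma finite_sifted: "finite K \<Longrightarrow> finite (sifted K E m n :: ('a \<Rightarrow> int ^ 's::finite) set)"
  unfolding sifted_def using finite_PiE_cube by (rule rev_finite_subset) auto

lemma card_sifted_mono:
  assumes "finite K" "n \<le> n'"
  shows "card (sifted K E m n :: ('a \<Rightarrow> int ^ 's::finite) set)
    \<le> card (sifted K E m n' :: ('a \<Rightarrow> int ^ 's) set)"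
proof (rule card_mono)
  show "finite (sifted K E m n' :: ('a \<Rightarrow> int ^ 's) set)"
    by (rule finite_sifted[OF assms(1)])
  have "(cube n :: (int ^ 's) set) \<subseteq> cube n'"
    using assms(2) unfolding cube_def by (auto intro: order_trans[of _ "int n"])
  then show "(sifted K E m n :: ('a \<Rightarrow> int ^ 's) set) \<subseteq> sifted K E m n'"
    by (auto simp: sifted_def PiE_iff)
qed

lemma tendsto_div_over:
  assumes "m > 0"
  shows "(\<lambda>n. real (n div m) / real n) \<longlonglongrightarrow> 1 / real m"
proof (rule tendsto_sandwich)
  show "\<forall>\<^sub>F n in sequentially. 1 / real m - 1 / real n \<le> real (n div m) / real n"
  \<comment> \<open>At n = 0, with division by zero giving 0, the bound would read 1/m \<le>
    0.\<close>
  proof (rule eventually_sequentiallyI[of 1])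
    fix n :: nat assume "n \<ge> 1"
    have "n \<le> m * (n div m + 1)" using dividend_less_times_div[OF assms, of n] by simp
    then have "real n \<le> real m * (real (n div m) + 1)"
      by (metis of_nat_le_iff of_nat_mult of_nat_add of_nat_1)
    then have "real n / real m - 1 \<le> real (n div m)"
      using assms by (simp add: field_simps)
    then have "(real n / real m - 1) / real n \<le> real (n div m) / real n"
      by (rule divide_right_mono) simp
    then show "1 / real m - 1 / real n \<le> real (n div m) / real n"
      using \<open>n \<ge> 1\<close> by (simp add: diff_divide_distrib)
  qed
  show "\<forall>\<^sub>F n in sequentially. real (n div m) / real n \<le> 1 / real m"
  proof (rule eventually_sequentiallyI[of 1])
    fix n :: nat assume "n \<ge> 1"
    have "real (n div m) / real n \<le> (real n / real m) / real n"
      by (intro divide_right_mono of_nat_div_le_of_nat) simp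
    then show "real (n div m) / real n \<le> 1 / real m" using \<open>n \<ge> 1\<close> by simp
  qed
  show "(\<lambda>n. 1 / real m - 1 / real n) \<longlonglongrightarrow> 1 / real m"
    using tendsto_diff[OF tendsto_const lim_1_over_n, of "1 / real m"] by simp
qed simp

text \<open>The count is monotone in the side and known exactly at multiples of \<open>m\<close>.
  Squeezing \<open>n\<close> between \<open>m * (n div m)\<close> and
  \<open>m * (n div m + 1)\<close> gives two bounds with the same limit.\<close>

lemma sifted_density:
  fixes m :: nat
  assumes "finite K" "E \<subseteq> K \<times> K" "m > 0"
  defines "d \<equiv> card K * CARD('s::finite)"
  shows "(\<lambda>n. real (card (sifted K E m n :: ('a \<Rightarrow> int ^ 's) set)) / real n ^ d) \<longlonglongrightarrow>
         real (card (sifted K E m m :: ('a \<Rightarrow> int ^ 's) set)) / real m ^ d"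
proof -
  define G where "G n = card (sifted K E m n :: ('a \<Rightarrow> int ^ 's) set)" for n
  have scale: "G (m * q) = G m * q ^ d" for q
    unfolding G_def d_def by (rule card_sifted_scale[OF assms(1-3)])
  have mono: "G n \<le> G n'" if "n \<le> n'" for n n'
    unfolding G_def by (rule card_sifted_mono[OF assms(1) that])
  have lim: "(\<lambda>n. real (G m) * (real (n div m) / real n) ^ d) \<longlonglongrightarrow> real (G m) * (1 / real m) ^ d"
    by (intro tendsto_intros tendsto_div_over assms)
  have "(\<lambda>n. real (n div m) / real n + 1 / real n) \<longlonglongrightarrow> 1 / real m"
    using tendsto_add[OF tendsto_div_over[OF assms(3)] lim_1_over_n] by simp
  then have lim': "(\<lambda>n. real (G m) * (real (n div m) / real n + 1 / real n) ^ d) \<longlonglongrightarrow>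
      real (G m) * (1 / real m) ^ d"
    by (intro tendsto_intros)
  have "(\<lambda>n. real (G n) / real n ^ d) \<longlonglongrightarrow> real (G m) * (1 / real m) ^ d"
  proof (rule tendsto_sandwich[OF _ _ lim lim'])
    have "real (G m) * (real (n div m) / real n) ^ d \<le> real (G n) / real n ^ d" for n
    proof -
      have "G m * (n div m) ^ d \<le> G n" using mono[of "m * (n div m)" n] scale by simp
      then have "real (G m) * real (n div m) ^ d \<le> real (G n)"
        by (metis of_nat_le_iff of_nat_mult of_nat_power)
      then show ?thesis by (simp add: power_divide divide_right_mono)
    qed
    then show "\<forall>\<^sub>F n in sequentially. real (G m) * (real (n div m) / real n) ^ d \<le> real (G n) / real n ^ d"
      by simp
    have "real (G n) / real n ^ d \<le> real (G m) * (real (n div m) / real n + 1 / real n) ^ d" for n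
    proof -
      have "n \<le> m * (n div m + 1)"
        using assms(3) dividend_less_times_div[of m n] by simp
      then have "G n \<le> G m * (n div m + 1) ^ d" using mono scale by metis
      then have "real (G n) \<le> real (G m * (n div m + 1) ^ d)" by (rule of_nat_mono)
      also have "\<dots> = real (G m) * (real (n div m) + 1) ^ d" by (simp add: add.commute)
      finally have "real (G n) \<le> real (G m) * (real (n div m) + 1) ^ d" .
      then have "real (G n) / real n ^ d \<le> real (G m) * (real (n div m) + 1) ^ d / real n ^ d"
        by (rule divide_right_mono) simp
      then show ?thesis by (simp add: power_divide add_divide_distrib[symmetric])
    qed
    then show "\<forall>\<^sub>F n in sequentially. real (G n) / real n ^ d
        \<le> real (G m) * (real (n div m) / real n + 1 / real n) ^ d"
      by simp
  qed
  then show ?thesis by (simp add: G_def power_divide)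
qed

section \<open>Tail estimate for congruent pairs\<close>

lemma card_residue_class_le:
  assumes "m > 0"
  shows "card {z \<in> {1..int n}. int m dvd z - y} \<le> n div m + 1"
proof -
  let ?A = "{z \<in> {1..int n}. int m dvd z - y}"
  have "card ?A \<le> card {0..int (n div m)}"
  proof (rule card_inj_on_le)
    \<comment> \<open>A block of \<open>m\<close> consecutive integers contains at most one member
      of a residue class. Block numbers start at 0, whence the \<open>+ 1\<close> in the
      bound.\<close>
    show "inj_on (\<lambda>z. (z - 1) div int m) ?A"
    proof (rule inj_onI)
      fix z w assume z: "z \<in> ?A" and w: "w \<in> ?A" and eq: "(z - 1) div int m = (w - 1) div int m"
      have "int m dvd (z - 1) - (w - 1)" using z w dvd_diff[of "int m" "z - y" "w - y"] by simp
      then have "(z - 1) mod int m = (w - 1) mod int m" by (simp add: mod_eq_dvd_iff)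
      then have "z - 1 = w - 1" using eq by (metis div_mult_mod_eq)
      then show "z = w" by simp
    qed
    show "(\<lambda>z. (z - 1) div int m) ` ?A \<subseteq> {0..int (n div m)}"
      using assms by (auto simp: pos_imp_zdiv_nonneg_iff zdiv_int intro!: zdiv_mono1)
  qed simp
  then show ?thesis by simp
qed

lemma card_cube_vec_cong_le:
  fixes Y :: "int ^ 's::finite"
  assumes "m > 0"
  shows "card {Z \<in> cube n. vec_cong m Z Y} \<le> (n div m + 1) ^ CARD('s)"
proof -
  have "{Z \<in> cube n. vec_cong m Z Y} = {Z. \<forall>i. Z $ i \<in> {z \<in> {1..int n}. int m dvd z - Y $ i}}"
    by (auto simp: cube_def vec_cong_def)
  then have "card {Z \<in> cube n. vec_cong m Z Y} =
      (\<Prod>i\<in>(UNIV :: 's set). card {z \<in> {1..int n}. int m dvd z - Y $ i})"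
    by (simp only: card_vec_coordinates)
  also have "\<dots> \<le> (\<Prod>i\<in>(UNIV :: 's set). n div m + 1)"
    by (intro prod_mono conjI card_residue_class_le assms) simp
  finally show ?thesis by simp
qed

text \<open>Choose all points except the one at \<open>u\<close> freely. That point must then lie in
  the residue class of the point at \<open>v\<close>, which is still among those chosen because
  \<open>u\<close> and \<open>v\<close> differ.\<close>

lemma card_pair_vec_cong_le:
  assumes "finite K" "u \<in> K" "v \<in> K" "u \<noteq> v" "m > 0"
  shows "card {X \<in> K \<rightarrow>\<^sub>E (cube n :: (int ^ 's::finite) set). vec_cong m (X u) (X v)}
    \<le> n ^ ((card K - 1) * CARD('s)) * (n div m + 1) ^ CARD('s)"
proof -
  let ?A = "{X \<in> K \<rightarrow>\<^sub>E (cube n :: (int ^ 's) set). vec_cong m (X u) (X v)}"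
  let ?B = "(K - {u}) \<rightarrow>\<^sub>E (cube n :: (int ^ 's) set)"
  let ?C = "\<lambda>Y :: 'a \<Rightarrow> int ^ 's. {Z \<in> cube n. vec_cong m Z (Y v)}"
  have finB: "finite ?B" using assms(1) by (intro finite_PiE_cube) simp
  have finC: "finite (?C Y)" for Y using finite_cube by (rule rev_finite_subset) auto
  have "card ?A \<le> card (Sigma ?B ?C)"
  proof (rule card_inj_on_le)
    show "inj_on (\<lambda>X. (restrict X (K - {u}), X u)) ?A"
    proof (rule inj_onI)
      fix X Y assume X: "X \<in> ?A" and Y: "Y \<in> ?A"
        and eq: "(restrict X (K - {u}), X u) = (restrict Y (K - {u}), Y u)"
      have "X w = Y w" if "w \<in> K" for w
      proof (cases "w = u")
        case False
        have "restrict X (K - {u}) w = restrict Y (K - {u}) w" using eq by simp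
        then show ?thesis using False that by simp
      qed (use eq in simp)
      then show "X = Y" using X Y by (auto intro: PiE_ext)
    qed
    show "(\<lambda>X. (restrict X (K - {u}), X u)) ` ?A \<subseteq> Sigma ?B ?C"
      using assms by (auto split: if_splits)
    show "finite (Sigma ?B ?C)" using finB finC by (rule finite_SigmaI)
  qed
  also have "\<dots> = (\<Sum>Y\<in>?B. card (?C Y))" using finB finC by simp
  also have "\<dots> \<le> (\<Sum>Y\<in>?B. (n div m + 1) ^ CARD('s))"
    by (intro sum_mono card_cube_vec_cong_le assms)
  also have "\<dots> = n ^ ((card K - 1) * CARD('s)) * (n div m + 1) ^ CARD('s)"
    using assms by (simp add: card_PiE_cube)
  finally show ?thesis .
qed

text \<open>For \<open>m\<close> at most \<open>n\<close>, \<open>n div m + 1\<close> is at most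
  2n/m, so the proportion of such tuples is at most (2/m)^s. Weakening this to 4/m^2 gives one
  summable bound for all s.\<close>

lemma density_pair_vec_cong_le:
  assumes "finite K" "u \<in> K" "v \<in> K" "u \<noteq> v" "2 \<le> m" "m \<le> n" "CARD('s::finite) \<ge> 2"
  shows "real (card {X \<in> K \<rightarrow>\<^sub>E (cube n :: (int ^ 's) set). vec_cong m (X u) (X v)})
    \<le> real n ^ (card K * CARD('s)) * (4 / real m ^ 2)"
proof -
  let ?s = "CARD('s)"
  \<comment> \<open>\<open>K\<close> contains \<open>u\<close>, so the subtraction on natural
    numbers is not truncated.\<close>
  have K: "card K * ?s = (card K - 1) * ?s + ?s"
    using assms(1,2) by (cases "card K") auto
  have n: "real n > 0" "real m > 0" using assms(5,6) by simp_all
  have "real (n div m) + 1 \<le> 2 * (real n / real m)"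
    using of_nat_div_le_of_nat[where 'a = real, of n m] assms(6) n by (simp add: field_simps)
  then have "(real (n div m) + 1) ^ ?s \<le> (real n * (2 / real m)) ^ ?s"
    by (intro power_mono) (auto simp: mult.commute)
  \<comment> \<open>As 2/m is at most 1, lowering the exponent from s to 2 can only increase the
    power.\<close>
  also have "\<dots> \<le> real n ^ ?s * (2 / real m) ^ 2"
    unfolding power_mult_distrib using assms(5,7)
    by (intro mult_left_mono power_decreasing) auto
  finally have le: "(real (n div m) + 1) ^ ?s \<le> real n ^ ?s * (4 / real m ^ 2)"
    by (simp add: power_divide)
  have "real (card {X \<in> K \<rightarrow>\<^sub>E (cube n :: (int ^ 's) set). vec_cong m (X u) (X v)})
      \<le> real (n ^ ((card K - 1) * ?s) * (n div m + 1) ^ ?s)"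
    using assms by (intro of_nat_mono card_pair_vec_cong_le) auto
  also have "\<dots> = real n ^ ((card K - 1) * ?s) * (real (n div m) + 1) ^ ?s"
    by (simp add: add.commute)
  also have "\<dots> \<le> real n ^ ((card K - 1) * ?s) * (real n ^ ?s * (4 / real m ^ 2))"
    by (intro mult_left_mono le) simp
  finally show ?thesis by (simp only: K power_add mult.assoc)
qed

text \<open>Telescoping: 1/(n+1)^2 is at most 1/n - 1/(n+1).\<close>

lemma sum_inverse_squares_le:
  assumes "N \<ge> 1" "N \<le> n"
  shows "(\<Sum>d\<in>{N<..n}. 1 / real d ^ 2) \<le> 1 / real N - 1 / real n"
  using assms(2)
proof (induction n rule: dec_induct)
  case (step n)
  have "{N<..Suc n} = insert (Suc n) {N<..n}" using step by auto
  moreover have "1 / real (Suc n) ^ 2 \<le> 1 / real n - 1 / real (Suc n)"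
  proof -
    have n: "real n > 0" using assms step by simp
    then have "1 / real (Suc n) ^ 2 \<le> 1 / (real n * real (Suc n))"
      by (intro divide_left_mono) (simp_all add: power2_eq_square)
    also have "\<dots> = 1 / real n - 1 / real (Suc n)" using n by (simp add: field_simps)
    finally show ?thesis .
  qed
  ultimately show ?case using step by simp
qed simp

section \<open>Comparison of visible and sifted tuples\<close>

definition visible_tuples :: "'a pair_pre_digraph \<Rightarrow> nat \<Rightarrow> ('a \<Rightarrow> int ^ 's) set" where
  "visible_tuples H n = {X \<in> pverts H \<rightarrow>\<^sub>E cube n. graph_visible H X}"

lemma graph_visible_iff:
  fixes X :: "'a \<Rightarrow> int ^ 's::finite"
  shows "graph_visible H X \<longleftrightarrow> (\<forall>(u, v)\<in>parcs H. \<forall>p. prime p \<longrightarrow> \<not> vec_cong p (X u) (X v))"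
  by (simp add: graph_visible_def mutually_visible_iff)

lemma visible_tuples_subset_sifted:
  "(visible_tuples H n :: ('a \<Rightarrow> int ^ 's::finite) set) \<subseteq> sifted (pverts H) (parcs H) m n"
  unfolding visible_tuples_def sifted_def sieve_def graph_visible_iff by blast

text \<open>An invisible arc has endpoints congruent modulo some prime, which the sieve forces above
  \<open>N\<close>. Letting \<open>d\<close> run through all integers up to \<open>n\<close> keeps
  the exceptional set a finite union even if that prime exceeds \<open>n\<close>.\<close>

lemma sifted_subset_visible_tuples:
  assumes "pair_wf_digraph H" "N < n"
  shows "sifted (pverts H) (parcs H) (\<Prod>{p. prime p \<and> p \<le> N}) n \<subseteq>
    visible_tuples H n \<union> (\<Union>(u, v)\<in>parcs H. \<Union>d\<in>{N<..n}.
      {X \<in> pverts H \<rightarrow>\<^sub>E (cube n :: (int ^ 's::finite) set). vec_cong d (X u) (X v)})"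
    (is "_ \<subseteq> _ \<union> ?B")
proof
  fix X :: "'a \<Rightarrow> int ^ 's"
  assume "X \<in> sifted (pverts H) (parcs H) (\<Prod>{p. prime p \<and> p \<le> N}) n"
  then have X: "X \<in> pverts H \<rightarrow>\<^sub>E cube n" and sieve: "sieve (parcs H) (\<Prod>{p. prime p \<and> p \<le> N}) X"
    by (auto simp: sifted_def)
  show "X \<in> visible_tuples H n \<union> ?B"
  proof (cases "graph_visible H X")
    case True
    then show ?thesis using X by (simp add: visible_tuples_def)
  next
    case False
    then obtain u v p where e: "(u, v) \<in> parcs H" and p: "prime p" and cong: "vec_cong p (X u) (X v)"
      unfolding graph_visible_iff by blast
    have wf: "u \<in> pverts H" "v \<in> pverts H"
      using pair_wf_digraph.in_arcsD1[OF assms(1) e] pair_wf_digraph.in_arcsD2[OF assms(1) e] by auto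
    have "p > N"
    proof (rule ccontr)
      assume "\<not> N < p"
      then have "p dvd \<Prod>{p. prime p \<and> p \<le> N}" using p by (intro dvd_prodI) auto
      then show False using sieve p e cong unfolding sieve_def by blast
    qed
    \<comment> \<open>A congruence modulo \<open>p > n\<close> forces equality, hence a congruence modulo \<open>n\<close>.\<close>
    have "\<exists>d\<in>{N<..n}. vec_cong d (X u) (X v)"
    proof (cases "p \<le> n")
      case True
      then show ?thesis using \<open>p > N\<close> cong by auto
    next
      case False
      then have "X u = X v"
        using cube_vec_cong_eq[OF PiE_mem[OF X wf(1)] PiE_mem[OF X wf(2)] cong] by simp
      then show ?thesis using assms(2) by auto
    qed
    then show ?thesis using X e by blast
  qed
qed

text \<open>Union bound over arcs and moduli: the proportions 4/d^2 for d > N sum to at most 4/N per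
  arc, uniformly in \<open>n\<close>.\<close>

lemma card_sifted_le_visible_tuples:
  assumes "pair_digraph H" "N \<ge> 1" "N < n" "CARD('s::finite) \<ge> 2"
  shows "real (card (sifted (pverts H) (parcs H) (\<Prod>{p. prime p \<and> p \<le> N}) n :: ('a \<Rightarrow> int ^ 's) set))
    \<le> real (card (visible_tuples H n :: ('a \<Rightarrow> int ^ 's) set)) +
       real n ^ (card (pverts H) * CARD('s)) * (4 * real (card (parcs H)) / real N)"
proof -
  note fin = pair_digraph.axioms(1)[OF assms(1)]
  note wf = pair_fin_digraph.axioms(1)[OF fin]
  note loopfree = pair_digraph.axioms(2)[OF assms(1)]
  note fin_verts = pair_fin_digraph.pair_finite_verts[OF fin]
    and fin_arcs = pair_fin_digraph.pair_finite_arcs[OF fin]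
  let ?D = "real n ^ (card (pverts H) * CARD('s))"
  define C :: "'a \<times> 'a \<Rightarrow> nat \<Rightarrow> ('a \<Rightarrow> int ^ 's) set"
    where "C e d = {X \<in> pverts H \<rightarrow>\<^sub>E cube n. vec_cong d (X (fst e)) (X (snd e))}" for e d
  have finC: "finite (C e d)" for e d
    unfolding C_def using finite_PiE_cube[OF fin_verts] by (rule rev_finite_subset) auto
  have finV: "finite (visible_tuples H n :: ('a \<Rightarrow> int ^ 's) set)"
    using finite_sifted[OF fin_verts] visible_tuples_subset_sifted by (rule rev_finite_subset)
  \<comment> \<open>Loop-freeness makes the endpoints distinct, and d > N \<ge> 1 gives the modulus
    at least 2.\<close>
  have C: "real (card (C e d)) \<le> ?D * 4 * (1 / real d ^ 2)" if "e \<in> parcs H" "d \<in> {N<..n}" for e d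
    using density_pair_vec_cong_le[of "pverts H" "fst e" "snd e" d n, where 's = 's] that assms
      fin_verts pair_wf_digraph.arc_fst_in_verts[OF wf] pair_wf_digraph.arc_snd_in_verts[OF wf]
      pair_loopfree_digraph.pair_no_loops[OF loopfree]
    unfolding C_def by auto
  have "card (sifted (pverts H) (parcs H) (\<Prod>{p. prime p \<and> p \<le> N}) n :: ('a \<Rightarrow> int ^ 's) set)
      \<le> card ((visible_tuples H n :: ('a \<Rightarrow> int ^ 's) set) \<union> (\<Union>e\<in>parcs H. \<Union>d\<in>{N<..n}. C e d))"
  proof (rule card_mono)
    show "sifted (pverts H) (parcs H) (\<Prod>{p. prime p \<and> p \<le> N}) n \<subseteq>
        (visible_tuples H n :: ('a \<Rightarrow> int ^ 's) set) \<union> (\<Union>e\<in>parcs H. \<Union>d\<in>{N<..n}. C e d)"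
      using sifted_subset_visible_tuples[OF wf assms(3)]
      unfolding C_def by (simp add: case_prod_beta)
  qed (use finV finC fin_arcs in auto)
  also have "\<dots> \<le> card (visible_tuples H n :: ('a \<Rightarrow> int ^ 's) set) + card (\<Union>e\<in>parcs H. \<Union>d\<in>{N<..n}. C e d)"
    by (rule card_Un_le)
  also have "card (\<Union>e\<in>parcs H. \<Union>d\<in>{N<..n}. C e d) \<le> (\<Sum>e\<in>parcs H. card (\<Union>d\<in>{N<..n}. C e d))"
    by (rule card_UN_le[OF fin_arcs])
  also have "\<dots> \<le> (\<Sum>e\<in>parcs H. \<Sum>d\<in>{N<..n}. card (C e d))"
    by (intro sum_mono card_UN_le) simp
  finally have "real (card (sifted (pverts H) (parcs H) (\<Prod>{p. prime p \<and> p \<le> N}) n :: ('a \<Rightarrow> int ^ 's) set))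
      \<le> real (card (visible_tuples H n :: ('a \<Rightarrow> int ^ 's) set) + (\<Sum>e\<in>parcs H. \<Sum>d\<in>{N<..n}. card (C e d)))"
    by (simp only: of_nat_le_iff)
  also have "\<dots> = real (card (visible_tuples H n :: ('a \<Rightarrow> int ^ 's) set))
      + (\<Sum>e\<in>parcs H. \<Sum>d\<in>{N<..n}. real (card (C e d)))"
    by simp
  also have "(\<Sum>e\<in>parcs H. \<Sum>d\<in>{N<..n}. real (card (C e d)))
      \<le> (\<Sum>e\<in>parcs H. \<Sum>d\<in>{N<..n}. ?D * 4 * (1 / real d ^ 2))"
    by (intro sum_mono C)
  also have "\<dots> = real (card (parcs H)) * (?D * 4 * (\<Sum>d\<in>{N<..n}. 1 / real d ^ 2))"
    by (simp only: sum_constant sum_distrib_left)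
  also have "\<dots> \<le> real (card (parcs H)) * (?D * 4 * (1 / real N))"
    using sum_inverse_squares_le[of N n] assms
    by (intro mult_left_mono) (auto intro: order_trans)
  finally show ?thesis by (simp add: mult_ac)
qed

text \<open>Exchange of limits: the error C/N is uniform in n > N, so N can be fixed first and n
  sent to infinity afterwards.\<close>

lemma LIMSEQ_of_approximations:
  fixes f :: "nat \<Rightarrow> real" and g :: "nat \<Rightarrow> nat \<Rightarrow> real"
  assumes "\<And>N. g N \<longlonglongrightarrow> a N" "a \<longlonglongrightarrow> A" "\<And>N n. f n \<le> g N n"
    and "\<And>N n. 1 \<le> N \<Longrightarrow> N < n \<Longrightarrow> g N n \<le> f n + C / real N"
  shows "f \<longlonglongrightarrow> A"
proof (rule LIMSEQ_I)
  fix e :: real assume e: "e > 0"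
  \<comment> \<open>Three errors below e/4 will add up: from \<open>f\<close> to \<open>g N\<close>,
    from \<open>g N\<close> to \<open>a N\<close>, and from \<open>a N\<close> to
    \<open>A\<close>.\<close>
  have "\<forall>\<^sub>F N in sequentially. dist (a N) A < e / 4"
    using assms(2) e by (intro tendstoD) auto
  moreover have "(\<lambda>N. C / real N) \<longlonglongrightarrow> 0"
    using tendsto_mult[OF tendsto_const lim_1_over_n, of C] by simp
  then have "\<forall>\<^sub>F N in sequentially. dist (C / real N) 0 < e / 4"
    using e by (intro tendstoD) auto
  moreover note eventually_ge_at_top[of 1]
  ultimately have "\<forall>\<^sub>F N in sequentially. dist (a N) A < e / 4 \<and> dist (C / real N) 0 < e / 4 \<and> 1 \<le> N"
    by eventually_elim simp
  then obtain N where N: "dist (a N) A < e / 4" "dist (C / real N) 0 < e / 4" "1 \<le> N"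
    using eventually_happens'[OF sequentially_bot] by blast
  have "\<forall>\<^sub>F n in sequentially. dist (g N n) (a N) < e / 4"
    using assms(1) e by (intro tendstoD) auto
  then have "\<forall>\<^sub>F n in sequentially. norm (f n - A) < e"
    using eventually_gt_at_top[of N]
  proof eventually_elim
    case (elim n)
    show ?case
      using N elim assms(3)[of n N] assms(4)[of N n] unfolding dist_real_def real_norm_def by linarith
  qed
  then show "\<exists>n0. \<forall>n\<ge>n0. norm (f n - A) < e"
    by (simp add: eventually_sequentially)
qed

section \<open>The Euler product\<close>

definition euler_factor :: "'a pair_pre_digraph \<Rightarrow> nat \<Rightarrow> nat \<Rightarrow> real" where
  "euler_factor H s p =
     (if prime p then poly (chromatic_poly H) (real (p ^ s)) / real (p ^ (card (pverts H) * s)) else 1)"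

text \<open>Identifies the real Euler factor, whose inverse in \<open>ennreal\<close> enters
  \<open>chromatic_zeta\<close>, with the proportion of tuples modulo p that are proper
  colorings.\<close>

lemma euler_factor_prime:
  assumes fin: "pair_fin_digraph H" and "prime p"
  shows "euler_factor H CARD('s) p =
    real (card (sifted (pverts H) (parcs H) p p :: ('a \<Rightarrow> int ^ 's::finite) set))
      / real p ^ (card (pverts H) * CARD('s))"
proof -
  note wf = pair_fin_digraph.axioms(1)[OF fin]
  note fin_verts = pair_fin_digraph.pair_finite_verts[OF fin]
  show ?thesis
    using assms(2) poly_chromatic_poly[OF wf fin_verts, of "p ^ CARD('s)"]
    by (simp add: euler_factor_def card_sifted_prime[OF wf] prime_gt_0_nat
        del: of_nat_power)
qed

lemma euler_factor_bounds:
  assumes fin: "pair_fin_digraph H"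
  shows "0 \<le> euler_factor H CARD('s::finite) p" "euler_factor H CARD('s) p \<le> 1"
proof -
  note fin_verts = pair_fin_digraph.pair_finite_verts[OF fin]
  let ?S = "sifted (pverts H) (parcs H) p p :: ('a \<Rightarrow> int ^ 's) set"
  have "card ?S \<le> card (pverts H \<rightarrow>\<^sub>E (cube p :: (int ^ 's) set))"
    by (intro card_mono finite_PiE_cube fin_verts) (auto simp: sifted_def)
  then have le: "real (card ?S) \<le> real p ^ (card (pverts H) * CARD('s))"
    by (simp add: card_PiE_cube fin_verts flip: of_nat_power)
  have "0 \<le> euler_factor H CARD('s) p \<and> euler_factor H CARD('s) p \<le> 1"
  proof (cases "prime p")
    case True
    show ?thesis
      unfolding euler_factor_prime[OF assms True]
      using le True by (simp add: prime_gt_0_nat)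
  qed (simp add: euler_factor_def)
  then show "0 \<le> euler_factor H CARD('s) p" "euler_factor H CARD('s) p \<le> 1" by auto
qed

lemma sifted_primorial_density:
  assumes fin: "pair_fin_digraph H"
  defines "d \<equiv> card (pverts H) * CARD('s::finite)"
  shows "(\<lambda>n. real (card (sifted (pverts H) (parcs H) (\<Prod>{p. prime p \<and> p \<le> N}) n
        :: ('a \<Rightarrow> int ^ 's) set)) / real n ^ d)
    \<longlonglongrightarrow> (\<Prod>p\<le>N. euler_factor H CARD('s) p)"
proof -
  note fin_verts = pair_fin_digraph.pair_finite_verts[OF fin]
  note wf = pair_fin_digraph.axioms(1)[OF fin]
  let ?S = "{p. prime p \<and> p \<le> N}"
  have E: "parcs H \<subseteq> pverts H \<times> pverts H"
    by (intro subsetI) (simp add: mem_Times_iff pair_wf_digraph.arc_fst_in_verts[OF wf]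
        pair_wf_digraph.arc_snd_in_verts[OF wf])
  have pos: "\<Prod>?S > 0" by (auto intro!: prod_pos prime_gt_0_nat)
  \<comment> \<open>Factors at non-primes are 1 by definition.\<close>
  have "(\<Prod>p\<le>N. euler_factor H CARD('s) p) = (\<Prod>p\<in>?S. euler_factor H CARD('s) p)"
    by (rule prod.mono_neutral_right) (auto simp: euler_factor_def)
  also have "\<dots> = (\<Prod>p\<in>?S. real (card (sifted (pverts H) (parcs H) p p :: ('a \<Rightarrow> int ^ 's) set)) / real p ^ d)"
    unfolding d_def by (intro prod.cong refl euler_factor_prime assms) simp
  also have "\<dots> = real (card (sifted (pverts H) (parcs H) (\<Prod>?S) (\<Prod>?S) :: ('a \<Rightarrow> int ^ 's) set)) / real (\<Prod>?S) ^ d"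
    by (subst card_sifted_primes[OF fin_verts E])
      (auto simp: prod_dividef prod_power_distrib)
  finally have eq: "(\<Prod>p\<le>N. euler_factor H CARD('s) p) = \<dots>" .
  show ?thesis
    unfolding eq unfolding d_def by (rule sifted_density[OF fin_verts E pos])
qed

text \<open>No exception arises, since inversion exchanges 0 and infinity.\<close>

lemma ennreal_inverse_inverse: "inverse (inverse x) = (x :: ennreal)"
proof (cases x rule: ennreal_cases)
  case (real r)
  then show ?thesis by (cases "r = 0") (simp_all add: inverse_ennreal)
qed simp

text \<open>In \<open>ennreal\<close> all factors of \<open>chromatic_zeta\<close> are at least 1,
  so the partial products increase to their supremum. Inversion is continuous on all of
  \<open>ennreal\<close>, which includes the case of an infinite value, as when some Euler factor is
  0.\<close>

lemma inverse_chromatic_zeta: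
  assumes fin: "pair_fin_digraph H"
  shows "(\<lambda>N. ennreal (\<Prod>p\<le>N. euler_factor H CARD('s::finite) p))
    \<longlonglongrightarrow> inverse (chromatic_zeta H CARD('s))"
proof -
  let ?a = "euler_factor H CARD('s)"
  define f where "f p = inverse (ennreal (?a p))" for p
  have a: "0 \<le> ?a p" "?a p \<le> 1" for p by (rule euler_factor_bounds[OF assms])+
  have f1: "1 \<le> f p" for p
    using a[of p] unfolding f_def
    by (cases "?a p = 0") (auto simp: inverse_ennreal one_le_inverse_iff simp flip: ennreal_1 intro!: ennreal_leI)
  have prod: "(\<Prod>p\<le>N. f p) = inverse (ennreal (\<Prod>p\<le>N. ?a p))" for N
    by (induction N)
      (simp_all add: f_def ennreal_mult ennreal_inverse_mult prod_nonneg a)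
  have "incseq (\<lambda>N. \<Prod>p\<le>N. f p)"
    using f1 by (intro incseq_SucI) (simp add: mult_left_mono[of 1 _ "\<Prod>p\<le>_. f p", simplified])
  then have lim: "(\<lambda>N. \<Prod>p\<le>N. f p) \<longlonglongrightarrow> (SUP N. \<Prod>p\<le>N. f p)" (is "_ \<longlonglongrightarrow> ?L")
    by (rule LIMSEQ_SUP)
  \<comment> \<open>The predicate \<open>has_prod\<close> accepts the limit 0 only if some factor is
    0.\<close>
  have "?L \<noteq> 0"
    using SUP_upper[of 0 UNIV "\<lambda>N. \<Prod>p\<le>N. f p"] f1[of 0] by auto
  have "chromatic_zeta H CARD('s) = prodinf f"
    unfolding chromatic_zeta_def f_def euler_factor_def
    by (intro arg_cong[of _ _ prodinf] ext) simp
  also have "\<dots> = ?L"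
    unfolding prodinf_def
  proof (rule the_equality)
    show "f has_prod ?L" using lim \<open>?L \<noteq> 0\<close> by (simp add: has_prod_def raw_has_prod_def)
    fix q assume "f has_prod q"
    \<comment> \<open>Rules out the clause of \<open>has_prod\<close> for products with a vanishing
      factor.\<close>
    moreover have "f p \<noteq> 0" for p using f1[of p] by auto
    ultimately have "(\<lambda>N. \<Prod>p\<le>N. f p) \<longlonglongrightarrow> q" by (simp add: has_prod_def raw_has_prod_def)
    then show "q = ?L" using lim by (rule LIMSEQ_unique)
  qed
  finally have zeta: "chromatic_zeta H CARD('s) = ?L" .
  have "(\<lambda>N. inverse (\<Prod>p\<le>N. f p)) \<longlonglongrightarrow> inverse ?L"
    using lim by (rule continuous_on_tendsto_compose[of UNIV inverse, OF continuous_on_inverse_ennreal[OF continuous_on_id]]) auto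
  then show ?thesis by (simp add: prod zeta[unfolded prod] ennreal_inverse_inverse)
qed

section \<open>The probability and its limit\<close>

lemma prob_graph_visible:
  assumes "pverts H = {1..k}" "n > 0"
  shows "measure_pmf.prob (random_points k n) {X :: nat \<Rightarrow> int ^ 's::finite. graph_visible H X} =
    real (card (visible_tuples H n :: (nat \<Rightarrow> int ^ 's) set)) / real n ^ (card (pverts H) * CARD('s))"
proof -
  let ?A = "pverts H \<rightarrow>\<^sub>E (cube n :: (int ^ 's) set)"
  have fin: "finite ?A" by (intro finite_PiE_cube) (simp add: assms)
  have "?A \<noteq> {}" by (simp add: PiE_eq_empty_iff cube_nonempty assms(2))
  \<comment> \<open>The default value \<open>undefined\<close> of \<open>random_points\<close> is
    the one extensional functions take off their domain, so independent uniform points are a uniform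
    element of \<open>?A\<close>.\<close>
  have "PiE_dflt {1..k} undefined (\<lambda>_. cube n :: (int ^ 's) set) = ?A"
    by (auto simp: PiE_dflt_def PiE_def extensional_def assms(1))
  then have "random_points k n = pmf_of_set ?A"
    unfolding random_points_def
    by (subst Pi_pmf_of_set) (simp_all add: finite_cube cube_nonempty assms(2))
  then have "measure_pmf.prob (random_points k n) {X :: nat \<Rightarrow> int ^ 's. graph_visible H X} =
      real (card (?A \<inter> {X. graph_visible H X})) / real (card ?A)"
    by (simp add: measure_pmf_of_set fin \<open>?A \<noteq> {}\<close>)
  also have "?A \<inter> {X. graph_visible H X} = visible_tuples H n" by (auto simp: visible_tuples_def)
  finally show ?thesis by (simp add: card_PiE_cube assms(1))
qed

theorem theorem2:
  fixes k :: nat and H :: "nat pair_pre_digraph"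
  assumes "CARD('s::finite) \<ge> 2" and "k \<ge> 2"
    and "pair_graph H" and "pverts H = {1..k}"
  shows "(\<lambda>n. ennreal (measure_pmf.prob (random_points k n) {X :: nat \<Rightarrow> int ^ 's. graph_visible H X}))
           \<longlonglongrightarrow> inverse (chromatic_zeta H CARD('s))"
proof -
  note digraph = pair_graph.axioms(1)[OF assms(3)]
  note fin_digraph = pair_digraph.axioms(1)[OF digraph]
  let ?d = "card (pverts H) * CARD('s)"
  let ?V = "\<lambda>n. visible_tuples H n :: (nat \<Rightarrow> int ^ 's) set"
  let ?S = "\<lambda>N n. sifted (pverts H) (parcs H) (\<Prod>{p. prime p \<and> p \<le> N}) n :: (nat \<Rightarrow> int ^ 's) set"
  define a where "a N = (\<Prod>p\<le>N. euler_factor H CARD('s) p)" for N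
  note bounds = euler_factor_bounds[OF fin_digraph, where 's = 's]
  have a0: "0 \<le> a N" for N unfolding a_def by (intro prod_nonneg ballI bounds)
  \<comment> \<open>All Euler factors lie between 0 and 1, so the partial products decrease to a
    limit, which may be 0.\<close>
  have "decseq a"
    unfolding a_def by (intro decseq_SucI) (simp add: mult_left_le prod_nonneg bounds)
  then obtain A where A: "a \<longlonglongrightarrow> A"
    by (rule decseq_convergent[where B = 0]) (simp add: a0)
  note fin = finite_sifted[OF pair_fin_digraph.pair_finite_verts[OF fin_digraph]]
  have "(\<lambda>n. real (card (?V n)) / real n ^ ?d) \<longlonglongrightarrow> A"
  proof (rule LIMSEQ_of_approximations[where g = "\<lambda>N n. real (card (?S N n)) / real n ^ ?d"])
    show "(\<lambda>n. real (card (?S N n)) / real n ^ ?d) \<longlonglongrightarrow> a N" for N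
      unfolding a_def by (rule sifted_primorial_density[OF fin_digraph])
    show "real (card (?V n)) / real n ^ ?d \<le> real (card (?S N n)) / real n ^ ?d" for N n
      by (intro divide_right_mono of_nat_mono card_mono fin visible_tuples_subset_sifted) simp
    show "real (card (?S N n)) / real n ^ ?d
        \<le> real (card (?V n)) / real n ^ ?d + 4 * real (card (parcs H)) / real N"
      if "1 \<le> N" "N < n" for N n
    proof -
      have "real (card (?S N n)) / real n ^ ?d
          \<le> (real (card (?V n)) + real n ^ ?d * (4 * real (card (parcs H)) / real N)) / real n ^ ?d"
        using that assms(1)
        by (intro divide_right_mono card_sifted_le_visible_tuples digraph) auto
      then show ?thesis using that by (simp add: add_divide_distrib)
    qed
  qed (fact A)
  then have "(\<lambda>n. ennreal (real (card (?V n)) / real n ^ ?d)) \<longlonglongrightarrow> ennreal A" by simp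
  \<comment> \<open>The side n = 0 is set aside because \<open>cube 0\<close> is empty and carries
    no uniform distribution.\<close>
  moreover have "\<forall>\<^sub>F n in sequentially. ennreal (real (card (?V n)) / real n ^ ?d) =
      ennreal (measure_pmf.prob (random_points k n) {X :: nat \<Rightarrow> int ^ 's. graph_visible H X})"
    using eventually_gt_at_top[of 0] by eventually_elim (simp only: prob_graph_visible[OF assms(4)])
  ultimately have "(\<lambda>n. ennreal (measure_pmf.prob (random_points k n) {X :: nat \<Rightarrow> int ^ 's. graph_visible H X}))
      \<longlonglongrightarrow> ennreal A"
    by (rule Lim_transform_eventually)
  \<comment> \<open>The real limit \<open>A\<close> and the inverse zeta value are limits of the
    same partial products in \<open>ennreal\<close>, hence equal.\<close>
  moreover have "(\<lambda>N. ennreal (a N)) \<longlonglongrightarrow> ennreal A" using A by simp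
  then have "ennreal A = inverse (chromatic_zeta H CARD('s))"
    using inverse_chromatic_zeta[OF fin_digraph, where 's = 's]
    unfolding a_def by (rule LIMSEQ_unique)
  ultimately show ?thesis by simp
qed

end
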